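(* For every integer $d\ge1$ and every $\epsilon>0$ there is $m_0=m_0(d,\epsilon)$ such that for all integers $m\ge m_0$ the following holds. Let $P_1=P_2=[m]^d$ and let $G=(P_1\sqcup P_2,E)$ be the bipartite graph where $x\in P_1$ is adjacent to $y\in P_2$ if $x_i=y_i$ for some $i\in[d]$. Then any homogeneous partition of $G$ with error $\epsilon$ must have at least $(2\epsilon)^{-d}$ parts.
   Context: $[m]=\{1,\dots,m\}$; $P_1$ and $P_2$ are regarded as disjoint vertex classes. Partitions $\Pi_1,\Pi_2$ of $P_1,P_2$ form a homogeneous partition of $G$ with error $\epsilon$ if $\sum\frac{|\pi_1||\pi_2|}{|P_1||P_2|}\le\epsilon$, where the sum is over pairs $(\pi_1,\pi_2)\in\Pi_1\times\Pi_2$ such that $E\cap(\pi_1\times\pi_2)$ is neither all of $\pi_1\times\pi_2$ nor empty. Such a homogeneous partition is said to have at least $K$ parts if $\max\{|\Pi_1|,|\Pi_2|\}\ge K$. *)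

theory Defs
  imports Complex_Main "HOL-Library.Disjoint_Sets" "HOL-Library.FuncSet"
begin

text \<open>
  A bipartite graph on \<open>P1 \<squnion> P2\<close> is given by its vertex classes \<open>P1\<close>, \<open>P2\<close> and its edge set
  \<open>E \<subseteq> P1 \<times> P2\<close>. Edges are ordered pairs, so \<open>x \<in> P1\<close> and \<open>x \<in> P2\<close> count as different
  vertices even when \<open>P1\<close> and \<open>P2\<close> are the same set.
\<close>

definition bipartite_graph :: "'a set \<Rightarrow> 'b set \<Rightarrow> ('a \<times> 'b) set \<Rightarrow> bool" where
  "bipartite_graph P1 P2 E \<longleftrightarrow> finite P1 \<and> finite P2 \<and> E \<subseteq> P1 \<times> P2"

definition homogeneous_pair :: "('a \<times> 'b) set \<Rightarrow> 'a set \<Rightarrow> 'b set \<Rightarrow> bool" where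
  "homogeneous_pair E A B \<longleftrightarrow> E \<inter> (A \<times> B) = A \<times> B \<or> E \<inter> (A \<times> B) = {}"

definition homogeneity_error ::
  "'a set \<Rightarrow> 'b set \<Rightarrow> ('a \<times> 'b) set \<Rightarrow> 'a set set \<Rightarrow> 'b set set \<Rightarrow> real" where
  "homogeneity_error P1 P2 E \<Pi>1 \<Pi>2 =
     (\<Sum>(A, B) \<in> {(A, B). A \<in> \<Pi>1 \<and> B \<in> \<Pi>2 \<and> \<not> homogeneous_pair E A B}.
        (real (card A) * real (card B)) / (real (card P1) * real (card P2)))"

definition homogeneous_partition ::
  "'a set \<Rightarrow> 'b set \<Rightarrow> ('a \<times> 'b) set \<Rightarrow> real \<Rightarrow> 'a set set \<Rightarrow> 'b set set \<Rightarrow> bool" where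
  "homogeneous_partition P1 P2 E \<epsilon> \<Pi>1 \<Pi>2 \<longleftrightarrow>
     bipartite_graph P1 P2 E \<and> partition_on P1 \<Pi>1 \<and> partition_on P2 \<Pi>2 \<and>
     homogeneity_error P1 P2 E \<Pi>1 \<Pi>2 \<le> \<epsilon>"

definition at_least_parts :: "real \<Rightarrow> 'a set set \<Rightarrow> 'b set set \<Rightarrow> bool" where
  "at_least_parts K \<Pi>1 \<Pi>2 \<longleftrightarrow> real (max (card \<Pi>1) (card \<Pi>2)) \<ge> K"

text \<open>
  \<open>[m]\<^sup>d\<close>, as functions on \<open>{1..d}\<close>; the extensional function space makes the value outside
  \<open>{1..d}\<close> irrelevant, so there are exactly \<open>m ^ d\<close> points.
\<close>

definition grid :: "nat \<Rightarrow> nat \<Rightarrow> (nat \<Rightarrow> nat) set" where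
  "grid m d = {1..d} \<rightarrow>\<^sub>E {1..m}"

definition grid_edges :: "nat \<Rightarrow> nat \<Rightarrow> ((nat \<Rightarrow> nat) \<times> (nat \<Rightarrow> nat)) set" where
  "grid_edges m d = {(x, y). x \<in> grid m d \<and> y \<in> grid m d \<and> (\<exists>i\<in>{1..d}. x i = y i)}"

lemma bipartite_graph_grid: "bipartite_graph (grid m d) (grid m d) (grid_edges m d)"
  unfolding bipartite_graph_def grid_edges_def grid_def by (auto intro!: finite_PiE)

end

theory Submission imports Defs
begin

text \<open>
  Some coordinate projection of a part \<open>A\<close> of density \<open>a\<close> has density \<open>t\<close> with \<open>t ^ d \<ge> a\<close>, so the
  parts of \<open>\<Pi>2\<close> joined to \<open>A\<close> by at least one edge have total density at least \<open>t\<close>. Summing the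
  convexity bound for \<open>a * a powr (1 / d)\<close> over \<open>K\<close> parts, the pairs containing an edge have total
  weight at least \<open>K powr (- 1 / d)\<close>. The complete pairs among them weigh at most the edge density,
  which is at most \<open>d / m \<le> \<epsilon>\<close>, and the others at most \<open>\<epsilon>\<close>.
\<close>

section \<open>A tangent-line inequality\<close>

text \<open>When \<open>a = t ^ d\<close> and d is positive, this is d times the tangent bound for
  the convex function a^(1 + 1/d) at the point \<open>c ^ d\<close>. Asking only for
  \<open>a \<le> t ^ d\<close> avoids roots and lets \<open>t\<close> be any sufficiently large
  projection density.\<close>

lemma power_tangent_bound:
  fixes a c t :: real
  assumes "0 \<le> a" "a \<le> t ^ d" "0 < t" "0 \<le> c"
  shows "(real d + 1) * c * a \<le> real d * (a * t) + c ^ Suc d"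
proof (cases "(real d + 1) * c \<le> real d * t")
  case True
  then have "((real d + 1) * c) * a \<le> (real d * t) * a"
    using assms(1) by (rule mult_right_mono)
  moreover have "0 \<le> c ^ Suc d" using assms(4) by simp
  ultimately show ?thesis by (simp add: algebra_simps)
next
  case False
  \<comment> \<open>Bernoulli at \<open>c / t - 1\<close>, rescaled by \<open>t ^ Suc d\<close>, is
    the tangent of s^(d + 1) at \<open>t\<close>, evaluated at \<open>c\<close>.\<close>
  have "1 + real (Suc d) * (c / t - 1) \<le> (1 + (c / t - 1)) ^ Suc d"
    by (rule Bernoulli_inequality) (use assms in simp)
  then have "(1 + real (Suc d) * (c / t - 1)) * t ^ Suc d \<le> (c / t) ^ Suc d * t ^ Suc d"
    using assms(3) by (intro mult_right_mono) auto
  also have "\<dots> = c ^ Suc d"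
    using assms(3) by (simp add: power_divide)
  also have "(1 + real (Suc d) * (c / t - 1)) * t ^ Suc d = t ^ d * ((real d + 1) * c - real d * t)"
    using assms(3) by (simp add: field_simps)
  finally have "t ^ d * ((real d + 1) * c - real d * t) \<le> c ^ Suc d" .
  \<comment> \<open>The bracket is positive in this case, so the factor \<open>t ^ d\<close> may be
    lowered to \<open>a\<close>.\<close>
  moreover have "a * ((real d + 1) * c - real d * t) \<le> t ^ d * ((real d + 1) * c - real d * t)"
    using assms(2) False by (intro mult_right_mono) auto
  ultimately show ?thesis by (simp add: algebra_simps)
qed

section \<open>Counting and projections in the grid\<close>

lemma finite_grid: "finite (grid m d)"
  unfolding grid_def by (intro finite_PiE) auto

lemma card_grid: "card (grid m d) = m ^ d"
  unfolding grid_def by (simp add: card_PiE)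

lemma card_grid_slab:
  assumes "i \<in> {1..d}" "S \<subseteq> {1..m}"
  shows "card {y \<in> grid m d. y i \<in> S} = card S * m ^ (d - 1)"
proof -
  have "{y \<in> grid m d. y i \<in> S} = (\<Pi>\<^sub>E j\<in>{1..d}. if j = i then S else {1..m})"
  proof (intro equalityI subsetI)
    fix y assume "y \<in> {y \<in> grid m d. y i \<in> S}"
    then show "y \<in> (\<Pi>\<^sub>E j\<in>{1..d}. if j = i then S else {1..m})"
      unfolding grid_def by (simp add: PiE_iff)
  next
    fix y assume y: "y \<in> (\<Pi>\<^sub>E j\<in>{1..d}. if j = i then S else {1..m})"
    have yj: "y j \<in> (if j = i then S else {1..m})" if "j \<in> {1..d}" for j
      using PiE_mem[OF y that] .
    then have "y j \<in> {1..m}" if "j \<in> {1..d}" for j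
      using that assms(2) by (metis subsetD)
    moreover have "y i \<in> S" using yj[OF assms(1)] by simp
    moreover have "y \<in> extensional {1..d}" using y by (simp add: PiE_def)
    ultimately show "y \<in> {y \<in> grid m d. y i \<in> S}"
      unfolding grid_def by (simp add: PiE_iff)
  qed
  also have "card \<dots> = (\<Prod>j\<in>{1..d}. if j = i then card S else m)"
    by (simp add: card_PiE if_distrib cong: if_cong)
  also have "\<dots> = card S * (\<Prod>j\<in>{1..d} - {i}. if j = i then card S else m)"
    using assms(1) by (subst prod.remove[of _ i]) auto
  also have "(\<Prod>j\<in>{1..d} - {i}. if j = i then card S else m) = m ^ (d - 1)"
    using assms(1) by (subst prod.cong[OF refl, of _ _ "\<lambda>_. m"]) auto
  finally show ?thesis .
qed

text \<open>\<open>A\<close> lies in the box spanned by its coordinate projections, so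
  \<open>card A\<close> is at most the product of their sizes, hence at most the \<open>d\<close>-th
  power of the largest.\<close>

lemma ex_large_projection:
  assumes "A \<subseteq> grid m d" "d \<ge> 1"
  shows "\<exists>i\<in>{1..d}. card A \<le> card ((\<lambda>x. x i) ` A) ^ d"
proof (rule ccontr)
  define p where "p i = card ((\<lambda>x. x i) ` A)" for i
  have "finite A" using assms(1) finite_grid finite_subset by blast
  have "Max (p ` {1..d}) \<in> p ` {1..d}" using assms(2) by (intro Max_in) auto
  then obtain k where k: "k \<in> {1..d}" "p k = Max (p ` {1..d})" by auto
  assume "\<not> ?thesis"
  then have "p k ^ d < card A" using k(1) unfolding p_def by (simp add: not_le)
  also have "card A \<le> card (\<Pi>\<^sub>E i\<in>{1..d}. (\<lambda>x. x i) ` A)"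
    using assms(1) \<open>finite A\<close> by (intro card_mono finite_PiE) (auto simp: grid_def)
  also have "\<dots> = (\<Prod>i\<in>{1..d}. p i)" by (simp add: card_PiE p_def)
  also have "\<dots> \<le> (\<Prod>i\<in>{1..d}. p k)" by (intro prod_mono) (auto simp: k(2))
  finally show False by simp
qed

text \<open>Union bound over the coordinate of agreement: each \<open>x\<close> agrees in coordinate
  \<open>i\<close> with \<open>m ^ (d - 1)\<close> points. For positive \<open>m\<close> the edge
  density is thus at most \<open>d / m\<close>.\<close>

lemma card_grid_edges_le: "card (grid_edges m d) \<le> d * (m ^ d * m ^ (d - 1))"
proof -
  \<comment> \<open>Agreement is phrased as membership in \<open>{x i}\<close> so that
    \<open>card_grid_slab\<close> counts the neighbours.\<close>
  have agree: "(\<exists>i\<in>{1..d}. x i = y i) \<longleftrightarrow> (\<exists>i\<in>{1..d}. y i \<in> {x i})" for x y :: "nat \<Rightarrow> nat"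
    by (metis singleton_iff)
  have "grid_edges m d = (\<Union>i\<in>{1..d}. SIGMA x:grid m d. {y \<in> grid m d. y i \<in> {x i}})"
    unfolding grid_edges_def agree by blast
  also have "card \<dots> \<le> (\<Sum>i\<in>{1..d}. card (SIGMA x:grid m d. {y \<in> grid m d. y i \<in> {x i}}))"
    by (rule card_UN_le) simp
  also have "\<dots> = (\<Sum>i\<in>{1..d}. m ^ d * m ^ (d - 1))"
  proof (rule sum.cong[OF refl])
    fix i assume i: "i \<in> {1..d}"
    have "card {y \<in> grid m d. y i \<in> {x i}} = m ^ (d - 1)" if "x \<in> grid m d" for x
    proof -
      have "x i \<in> {1..m}" using that i unfolding grid_def by (rule PiE_mem)
      then show ?thesis using card_grid_slab[OF i, of "{x i}" m] by simp
    qed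
    then show "card (SIGMA x:grid m d. {y \<in> grid m d. y i \<in> {x i}}) = m ^ d * m ^ (d - 1)"
      by (simp add: finite_grid card_grid)
  qed
  finally show ?thesis by simp
qed

section \<open>Weights of pairs of parts in a bipartite graph\<close>

lemma partition_on_finite_part:
  assumes "finite P" "partition_on P \<Pi>1" "A \<in> \<Pi>1"
  shows "finite A"
  using assms partition_onD1 by (metis Union_upper finite_subset)

lemma card_le_sum_meeting_parts:
  assumes "finite P" "partition_on P \<Pi>1" "S \<subseteq> P"
  shows "card S \<le> (\<Sum>B\<in>{B \<in> \<Pi>1. B \<inter> S \<noteq> {}}. card B)"
proof -
  have fin: "finite \<Pi>1" by (rule finite_elements[OF assms(1,2)])
  have "S \<subseteq> \<Union>{B \<in> \<Pi>1. B \<inter> S \<noteq> {}}"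
    using assms(3) unfolding partition_onD1[OF assms(2)] by blast
  then have "card S \<le> card (\<Union>{B \<in> \<Pi>1. B \<inter> S \<noteq> {}})"
    using fin partition_on_finite_part[OF assms(1,2)] by (intro card_mono finite_Union) auto
  also have "\<dots> \<le> (\<Sum>B\<in>{B \<in> \<Pi>1. B \<inter> S \<noteq> {}}. card B)" by (rule card_Union_le_sum_card)
  finally show ?thesis .
qed

text \<open>Distinct pairs of parts span disjoint rectangles, and those of complete pairs all lie
  inside \<open>E\<close>.\<close>

lemma sum_complete_pairs_le:
  assumes "finite E" "finite P1" "finite P2" "partition_on P1 \<Pi>1" "partition_on P2 \<Pi>2"
  shows "(\<Sum>(A, B)\<in>{(A, B). A \<in> \<Pi>1 \<and> B \<in> \<Pi>2 \<and> A \<times> B \<subseteq> E}. card A * card B) \<le> card E"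
proof -
  let ?F = "{(A, B). A \<in> \<Pi>1 \<and> B \<in> \<Pi>2 \<and> A \<times> B \<subseteq> E}"
  have "finite (\<Pi>1 \<times> \<Pi>2)"
    by (intro finite_cartesian_product finite_elements[OF assms(2,4)] finite_elements[OF assms(3,5)])
  then have fin: "finite ?F" by (rule rev_finite_subset) auto
  have "(\<Sum>(A, B)\<in>?F. card A * card B) = (\<Sum>p\<in>?F. card (fst p \<times> snd p))"
    by (simp add: case_prod_beta card_cartesian_product)
  also have "\<dots> = card (\<Union>p\<in>?F. fst p \<times> snd p)"
  proof (rule card_UN_disjoint[symmetric, OF fin])
    show "\<forall>p\<in>?F. finite (fst p \<times> snd p)"
      using partition_on_finite_part[OF assms(2,4)] partition_on_finite_part[OF assms(3,5)] by auto
    show "\<forall>p\<in>?F. \<forall>q\<in>?F. p \<noteq> q \<longrightarrow> (fst p \<times> snd p) \<inter> (fst q \<times> snd q) = {}"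
    proof (intro ballI impI)
      fix p q assume pq: "p \<in> ?F" "q \<in> ?F" "p \<noteq> q"
      then have "fst p \<noteq> fst q \<or> snd p \<noteq> snd q" by (simp add: prod_eq_iff)
      moreover have "fst p \<in> \<Pi>1" "fst q \<in> \<Pi>1" "snd p \<in> \<Pi>2" "snd q \<in> \<Pi>2"
        using pq by auto
      ultimately have "fst p \<inter> fst q = {} \<or> snd p \<inter> snd q = {}"
        using disjointD[OF partition_onD2[OF assms(4)], of "fst p" "fst q"]
          disjointD[OF partition_onD2[OF assms(5)], of "snd p" "snd q"]
        by argo
      then show "(fst p \<times> snd p) \<inter> (fst q \<times> snd q) = {}" by auto
    qed
  qed
  also have "\<dots> \<le> card E" by (rule card_mono[OF assms(1)]) auto
  finally show ?thesis .
qed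

text \<open>A pair of parts containing an edge is either inhomogeneous, and charged to the error, or
  complete, and charged to the edge density.\<close>

lemma joined_weight_le:
  assumes "homogeneous_partition P1 P2 E \<epsilon> \<Pi>1 \<Pi>2"
  shows "(\<Sum>A\<in>\<Pi>1. \<Sum>B\<in>{B \<in> \<Pi>2. E \<inter> (A \<times> B) \<noteq> {}}.
            real (card A) * real (card B) / (real (card P1) * real (card P2)))
         \<le> \<epsilon> + real (card E) / (real (card P1) * real (card P2))"
proof -
  let ?N = "real (card P1) * real (card P2)"
  let ?w = "\<lambda>(A, B). real (card A) * real (card B) / ?N"
  let ?H = "{(A, B). A \<in> \<Pi>1 \<and> B \<in> \<Pi>2 \<and> \<not> homogeneous_pair E A B}"
  let ?F = "{(A, B). A \<in> \<Pi>1 \<and> B \<in> \<Pi>2 \<and> A \<times> B \<subseteq> E}"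
  have fP: "finite P1" "finite P2" and E: "E \<subseteq> P1 \<times> P2"
    and part: "partition_on P1 \<Pi>1" "partition_on P2 \<Pi>2" and err: "sum ?w ?H \<le> \<epsilon>"
    using assms
    unfolding homogeneous_partition_def bipartite_graph_def homogeneity_error_def by auto
  have fin: "finite \<Pi>1" "finite \<Pi>2" using finite_elements[OF fP(1) part(1)] finite_elements[OF fP(2) part(2)] .
  then have fin2: "finite (\<Pi>1 \<times> \<Pi>2)" by simp
  have fH: "finite ?H" by (rule rev_finite_subset[OF fin2]) auto
  have fF: "finite ?F" by (rule rev_finite_subset[OF fin2]) auto
  have fE: "finite E" by (rule finite_subset[OF E]) (simp add: fP)
  have "(\<Sum>A\<in>\<Pi>1. \<Sum>B\<in>{B \<in> \<Pi>2. E \<inter> (A \<times> B) \<noteq> {}}. ?w (A, B))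
      = sum ?w (SIGMA A:\<Pi>1. {B \<in> \<Pi>2. E \<inter> (A \<times> B) \<noteq> {}})"
    using fin by (subst sum.Sigma) auto
  also have "\<dots> \<le> sum ?w (?H \<union> ?F)"
    using fH fF by (intro sum_mono2) (auto simp: homogeneous_pair_def)
  also have "\<dots> \<le> sum ?w ?H + sum ?w ?F"
  proof -
    have "0 \<le> sum ?w (?H \<inter> ?F)" by (rule sum_nonneg) auto
    then show ?thesis using sum.union_inter[OF fH fF, of ?w] by linarith
  qed
  also have "sum ?w ?F = real (\<Sum>(A, B)\<in>?F. card A * card B) / ?N"
    by (simp add: sum_divide_distrib case_prod_beta)
  also have "\<dots> \<le> real (card E) / ?N"
    using sum_complete_pairs_le[OF fE fP part] by (intro divide_right_mono of_nat_mono) auto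
  finally show ?thesis using err by simp
qed

section \<open>Lower bound for the joined weight and the count of parts\<close>

text \<open>\<open>t\<close> is the density in \<open>{1..m}\<close> of a coordinate projection from
  \<open>ex_large_projection\<close>. The slab of points whose \<open>i\<close>-th coordinate lies
  in that projection has density \<open>t\<close>, and every part meeting it is joined to
  \<open>A\<close>. Here \<open>\<Pi>1\<close> stands for the partition of the second class.\<close>

lemma grid_joined_weight_ge:
  assumes "partition_on (grid m d) \<Pi>1" "A \<subseteq> grid m d" "A \<noteq> {}" "d \<ge> 1"
  obtains t :: real where "0 < t" "real (card A) / real m ^ d \<le> t ^ d"
    and "t \<le> (\<Sum>B\<in>{B \<in> \<Pi>1. grid_edges m d \<inter> (A \<times> B) \<noteq> {}}. real (card B)) / real m ^ d"
proof -
  let ?J = "{B \<in> \<Pi>1. grid_edges m d \<inter> (A \<times> B) \<noteq> {}}"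
  obtain i where i: "i \<in> {1..d}" and le: "card A \<le> card ((\<lambda>x. x i) ` A) ^ d"
    using ex_large_projection[OF assms(2,4)] by blast
  let ?p = "(\<lambda>x. x i) ` A"
  let ?S = "{y \<in> grid m d. y i \<in> ?p}"
  have p: "?p \<subseteq> {1..m}" using assms(2) i unfolding grid_def by (blast dest: PiE_mem)
  then have "finite ?p" using finite_subset by blast
  then have "card ?p > 0" using assms(3) by (simp add: card_gt_0_iff)
  have m: "m > 0" using p assms(3) by (cases m) auto
  have "card ?p * m ^ (d - 1) = card ?S" using card_grid_slab[OF i p] by simp
  also have "\<dots> \<le> (\<Sum>B\<in>{B \<in> \<Pi>1. B \<inter> ?S \<noteq> {}}. card B)"
    by (rule card_le_sum_meeting_parts[OF finite_grid assms(1)]) auto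
  also have "\<dots> \<le> (\<Sum>B\<in>?J. card B)"
  proof (rule sum_mono2)
    show "finite ?J" using finite_elements[OF finite_grid assms(1)] by simp
    show "{B \<in> \<Pi>1. B \<inter> ?S \<noteq> {}} \<subseteq> ?J"
    proof
      fix B assume "B \<in> {B \<in> \<Pi>1. B \<inter> ?S \<noteq> {}}"
      then obtain x y where B: "B \<in> \<Pi>1" "y \<in> B" "y \<in> grid m d" "x \<in> A" "y i = x i" by blast
      then have "(x, y) \<in> grid_edges m d"
        using assms(2) i unfolding grid_edges_def by (auto intro!: bexI[of _ i])
      then show "B \<in> ?J" using B by blast
    qed
  qed auto
  finally have "real (card ?p * m ^ (d - 1)) \<le> real (\<Sum>B\<in>?J. card B)"
    by (rule of_nat_mono)
  then have "real (card ?p) * real m ^ (d - 1) / real m ^ d \<le> (\<Sum>B\<in>?J. real (card B)) / real m ^ d"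
    by (intro divide_right_mono) auto
  \<comment> \<open>As \<open>d \<ge> 1\<close>, exactly one factor \<open>m\<close> survives the
    cancellation.\<close>
  moreover have "real (card ?p) * real m ^ (d - 1) / real m ^ d = real (card ?p) / real m"
    using m assms(4) by (cases d) auto
  ultimately have "real (card ?p) / real m \<le> (\<Sum>B\<in>?J. real (card B)) / real m ^ d" by simp
  moreover have "real (card A) / real m ^ d \<le> (real (card ?p) / real m) ^ d"
  proof -
    have "real (card A) \<le> real (card ?p ^ d)" using le by (rule of_nat_mono)
    then show ?thesis by (simp add: power_divide divide_right_mono)
  qed
  moreover have "0 < real (card ?p) / real m" using m \<open>card ?p > 0\<close> by simp
  ultimately show ?thesis using that by blast
qed

theorem proposition7p4:
  fixes d :: nat and \<epsilon> :: real
  assumes "d \<ge> 1" and "\<epsilon> > 0"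
  shows "\<exists>m0::nat. \<forall>m\<ge>m0. \<forall>\<Pi>1 \<Pi>2.
           homogeneous_partition (grid m d) (grid m d) (grid_edges m d) \<epsilon> \<Pi>1 \<Pi>2 \<longrightarrow>
           at_least_parts ((2 * \<epsilon>) powi (- int d)) \<Pi>1 \<Pi>2"
proof (intro exI allI impI)
  fix m :: nat and \<Pi>1 \<Pi>2
  \<comment> \<open>This fixes the threshold: from \<open>d / \<epsilon>\<close> on, the edge
    density bound \<open>d / m\<close> is at most \<open>\<epsilon>\<close>.\<close>
  assume m: "m \<ge> nat \<lceil>real d / \<epsilon>\<rceil>"
    and hom: "homogeneous_partition (grid m d) (grid m d) (grid_edges m d) \<epsilon> \<Pi>1 \<Pi>2"
  \<comment> \<open>\<open>c\<close> has two roles: it bounds the total joined weight, as error plus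
    edge density, and \<open>c ^ d\<close> is the part density at which the tangent is taken, the
    one that c^(-d) equal parts would have.\<close>
  define c where "c = 2 * \<epsilon>"
  have c: "c > 0" using assms(2) by (simp add: c_def)
  have mge: "real m \<ge> real d / \<epsilon>" using m by linarith
  moreover have "real d / \<epsilon> > 0" using assms by simp
  ultimately have m0: "m > 0" by linarith
  have part: "partition_on (grid m d) \<Pi>1" "partition_on (grid m d) \<Pi>2"
    using hom unfolding homogeneous_partition_def by auto
  let ?w = "\<lambda>A. \<Sum>B\<in>{B \<in> \<Pi>2. grid_edges m d \<inter> (A \<times> B) \<noteq> {}}.
                  real (card A) * real (card B) / (real m ^ d * real m ^ d)"
  let ?a = "\<lambda>A. real (card A) / real m ^ d"
  have "real (card (grid_edges m d)) \<le> real (d * (m ^ d * m ^ (d - 1)))"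
    by (rule of_nat_mono[OF card_grid_edges_le])
  then have "real (card (grid_edges m d)) / (real m ^ d * real m ^ d)
      \<le> real (d * (m ^ d * m ^ (d - 1))) / (real m ^ d * real m ^ d)"
    by (intro divide_right_mono) auto
  also have "\<dots> = real d / real m" using m0 assms(1) by (cases d) (auto simp: field_simps)
  also have "\<dots> \<le> \<epsilon>" using mge m0 assms(2) by (simp add: field_simps)
  finally have upper: "(\<Sum>A\<in>\<Pi>1. ?w A) \<le> c"
    using joined_weight_le[OF hom] by (simp add: card_grid c_def)
  \<comment> \<open>The weight joined to \<open>A\<close> is at least \<open>?a A * t\<close>; the
    tangent makes the bound linear in \<open>?a A\<close>, so its sum depends only on the total
    density and the number of parts.\<close>
  have pointwise: "(real d + 1) * c * ?a A \<le> real d * ?w A + c ^ Suc d" if A: "A \<in> \<Pi>1" for A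
  proof -
    have "A \<subseteq> grid m d" "A \<noteq> {}"
      using A partition_onD1[OF part(1)] partition_onD3[OF part(1)] by auto
    then obtain t where t: "0 < t" "?a A \<le> t ^ d"
      "t \<le> (\<Sum>B\<in>{B \<in> \<Pi>2. grid_edges m d \<inter> (A \<times> B) \<noteq> {}}. real (card B)) / real m ^ d"
      using grid_joined_weight_ge[OF part(2) _ _ assms(1)] by blast
    have "?a A * t \<le> ?a A *
      ((\<Sum>B\<in>{B \<in> \<Pi>2. grid_edges m d \<inter> (A \<times> B) \<noteq> {}}. real (card B)) / real m ^ d)"
      using t(3) by (intro mult_left_mono) auto
    also have "\<dots> = ?w A" by (simp add: sum_distrib_left sum_divide_distrib)
    finally have "real d * (?a A * t) \<le> real d * ?w A" by (intro mult_left_mono) auto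
    moreover have "(real d + 1) * c * ?a A \<le> real d * (?a A * t) + c ^ Suc d"
      using t c by (intro power_tangent_bound) auto
    ultimately show ?thesis by linarith
  qed
  have "(\<Sum>A\<in>\<Pi>1. card A) = card (grid m d)"
    using partition_onD1[OF part(1)] partition_onD2[OF part(1)]
      partition_on_finite_part[OF finite_grid part(1)]
    by (subst card_Union_disjoint[symmetric]) (auto simp: disjoint_def pairwise_def disjnt_def)
  then have "(\<Sum>A\<in>\<Pi>1. real (card A)) = real m ^ d"
    by (metis card_grid of_nat_power of_nat_sum)
  then have "(\<Sum>A\<in>\<Pi>1. ?a A) = 1" using m0 by (simp flip: sum_divide_distrib)
  then have "(real d + 1) * c = (\<Sum>A\<in>\<Pi>1. (real d + 1) * c * ?a A)"
    by (simp only: flip: sum_distrib_left)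
  also have "\<dots> \<le> (\<Sum>A\<in>\<Pi>1. real d * ?w A + c ^ Suc d)"
    by (rule sum_mono[OF pointwise])
  also have "\<dots> = real d * (\<Sum>A\<in>\<Pi>1. ?w A) + real (card \<Pi>1) * c ^ Suc d"
    by (simp add: sum.distrib sum_distrib_left)
  also have "\<dots> \<le> real d * c + real (card \<Pi>1) * c ^ Suc d"
    using upper by (intro add_right_mono mult_left_mono) auto
  \<comment> \<open>Subtracting \<open>real d * c\<close> leaves a single \<open>c\<close> on the
    left, and dividing by it isolates the number of parts.\<close>
  finally have "c * 1 \<le> c * (real (card \<Pi>1) * c ^ d)" by (simp add: algebra_simps)
  then have "1 \<le> real (card \<Pi>1) * c ^ d" using c by (simp only: mult_le_cancel_left_pos)
  then have "c powi (- int d) \<le> real (card \<Pi>1)"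
    using c by (simp add: power_int_minus field_simps)
  \<comment> \<open>The lower bound for \<open>card \<Pi>1\<close> passes to the maximum.\<close>
  then show "at_least_parts ((2 * \<epsilon>) powi (- int d)) \<Pi>1 \<Pi>2"
    unfolding at_least_parts_def c_def by linarith
qed

end
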